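(* Let $\mathbb{R}_{++}^{2} = \{(x,y) \in \mathbb{R}^{2} \mid x > 0,\ y > 0\}$. The function $f(x,y) = -\dfrac{xy}{x+y}$ with domain $\operatorname{dom} f = \mathbb{R}_{++}^{2}$ is a convex function, which entails that its epigraph $\operatorname{epi} f = \{(x,y,z) \mid (x,y) \in \operatorname{dom} f,\ f(x,y) \le z\}$ (with $z \in \mathbb{R}$) is a convex set.
   Context: $\operatorname{dom} f$ denotes the domain of $f$ and $\operatorname{epi} f \subseteq \mathbb{R}^3$ its epigraph. Convexity of functions and sets is in the standard sense. *)

theory Defs
  imports "HOL-Analysis.Analysis"
begin

definition pos_quadrant :: "(real \<times> real) set" where
  "pos_quadrant = {(x, y). 0 < x \<and> 0 < y}"

text \<open>As HOL functions are total, the domain of the function below is not part of it; it is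
  given by the set argument of \<^const>\<open>convex_on\<close> and \<^const>\<open>epigraph\<close>. The epigraph lives
  in \<open>(real \<times> real) \<times> real\<close>, i.e. the point \<open>(x, y, z)\<close> of three-space is \<open>((x, y), z)\<close>.\<close>

definition neg_parallel_sum :: "real \<times> real \<Rightarrow> real" where
  "neg_parallel_sum = (\<lambda>(x, y). - ((x * y) / (x + y)))"

end

theory Submission
  imports Defs
begin

text \<open>The parallel sum \<open>x y / (x + y)\<close> is the least energy dissipated per unit time when a unit
  current is split as \<open>t\<close> and \<open>1 - t\<close> between two parallel resistors \<open>x\<close> and \<open>y\<close>:
  \<open>x y / (x + y) = min\<^sub>t (t\<^sup>2 x + (1 - t)\<^sup>2 y)\<close>, because completing the square in \<open>t\<close> gives
  \<open>t\<^sup>2 x + (1 - t)\<^sup>2 y - x y / (x + y) = (t (x + y) - y)\<^sup>2 / (x + y)\<close>.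
  For fixed \<open>t\<close> the energy is linear in \<open>(x, y)\<close>, so the negated parallel sum is a pointwise
  maximum of linear functions on the quadrant, and therefore convex. Convexity of the epigraph
  is then equivalent to convexity of the function.\<close>

definition neg_split_energy :: "real \<Rightarrow> real \<times> real \<Rightarrow> real" where
  "neg_split_energy t p = - (t\<^sup>2 * fst p + (1 - t)\<^sup>2 * snd p)"

lemma linear_neg_split_energy: "linear (neg_split_energy t)"
  by (rule linearI) (simp_all add: neg_split_energy_def algebra_simps)

lemma neg_parallel_sum_eq_energy_plus_square:
  assumes "p \<in> pos_quadrant"
  shows "neg_parallel_sum p = neg_split_energy t p
    + (t * (fst p + snd p) - snd p)\<^sup>2 / (fst p + snd p)"
proof -
  obtain x y where p: "p = (x, y)" "0 < x" "0 < y"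
    using assms by (auto simp: pos_quadrant_def)
  hence "x + y \<noteq> 0" by simp
  thus ?thesis
    by (simp add: p neg_parallel_sum_def neg_split_energy_def field_simps power2_eq_square)
qed

lemma neg_split_energy_le_neg_parallel_sum:
  assumes "p \<in> pos_quadrant"
  shows "neg_split_energy t p \<le> neg_parallel_sum p"
  using assms neg_parallel_sum_eq_energy_plus_square[OF assms, of t]
  by (auto simp: pos_quadrant_def)

text \<open>The maximum is attained by the split at which the square vanishes; this is the current
  division that physics dictates, with the smaller current through the larger resistor.\<close>

lemma neg_parallel_sum_eq_optimal_split:
  assumes "p \<in> pos_quadrant"
  shows "neg_parallel_sum p = neg_split_energy (snd p / (fst p + snd p)) p"
proof -
  have "fst p + snd p \<noteq> 0"
    using assms by (auto simp: pos_quadrant_def)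
  thus ?thesis
    using neg_parallel_sum_eq_energy_plus_square[OF assms, of "snd p / (fst p + snd p)"] by simp
qed

lemma convex_pos_quadrant: "convex pos_quadrant"
proof -
  have "pos_quadrant = {0<..} \<times> {0<..}"
    by (auto simp: pos_quadrant_def)
  thus ?thesis
    by (metis convex_Times convex_real_interval(3))
qed

lemma convex_on_neg_parallel_sum: "convex_on pos_quadrant neg_parallel_sum"
  unfolding convex_on_def
proof (intro conjI convex_pos_quadrant ballI allI impI)
  fix p q :: "real \<times> real" and u v :: real
  assume pq: "p \<in> pos_quadrant" "q \<in> pos_quadrant" and uv: "0 \<le> u" "0 \<le> v" "u + v = 1"
  define m where "m = u *\<^sub>R p + v *\<^sub>R q"
  have m: "m \<in> pos_quadrant"
    unfolding m_def by (rule convexD[OF convex_pos_quadrant pq uv])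
  \<comment> \<open>One split, the one optimal at the mixed point, is used at all three points: its negated
    energy equals the function at \<open>m\<close> and bounds it from below at \<open>p\<close> and \<open>q\<close>.\<close>
  define t where "t = snd m / (fst m + snd m)"
  have "neg_parallel_sum m = neg_split_energy t m"
    unfolding t_def by (rule neg_parallel_sum_eq_optimal_split[OF m])
  also have "\<dots> = u * neg_split_energy t p + v * neg_split_energy t q"
    by (simp add: m_def linear_add[OF linear_neg_split_energy]
        linear_scale[OF linear_neg_split_energy])
  also have "\<dots> \<le> u * neg_parallel_sum p + v * neg_parallel_sum q"
    using pq uv by (intro add_mono mult_left_mono neg_split_energy_le_neg_parallel_sum)
  finally show "neg_parallel_sum (u *\<^sub>R p + v *\<^sub>R q)
      \<le> u * neg_parallel_sum p + v * neg_parallel_sum q"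
    unfolding m_def .
qed

theorem theorem1:
  shows "convex_on pos_quadrant neg_parallel_sum \<and>
    convex (epigraph pos_quadrant neg_parallel_sum)"
  using convex_on_neg_parallel_sum by (simp add: convex_epigraph)

end
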